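(* There is a constant $c>0$ depending only on the dimension $n$ such that the following holds. Let $w$ be a weight on $\mathbb{R}^n$, let $q>1$, and let $Y:\mathcal{Q}\to(0,\infty)$ be a functional with $Y\in\mathcal{Y}_q$. Suppose further that $w(Q)\le Y(Q)$ for every cube $Q\in\mathcal{Q}$. Then for every $f\in\mathrm{BMO}$, every $p\ge 1$ and every cube $Q\in\mathcal{Q}$, $$\left(\frac{1}{Y(Q)}\int_Q|f-f_Q|^p\,w\,dx\right)^{1/p}\le c\,p\,q\,\beta_Y\,\|f\|_{\mathrm{BMO}}.$$
   Context: A weight is a non-negative locally integrable function on $\mathbb{R}^n$; $w(Q)=\int_Q w\,dx$. $\mathcal{Q}$ is the family of all cubes in $\mathbb{R}^n$ with sides parallel to the axes. For $f\in L^1_{loc}(\mathbb{R}^n)$, $f_Q=\frac{1}{|Q|}\int_Q f$, $\|f\|_{\mathrm{BMO}}=\sup_{Q\in\mathcal{Q}}\frac{1}{|Q|}\int_Q|f-f_Q|\,dx$, and $\mathrm{BMO}$ is the set of $f\in L^1_{loc}(\mathbb{R}^n)$ with $\|f\|_{\mathrm{BMO}}<\infty$. A family $\{Q_i\}$ of pairwise disjoint subcubes of a cube $Q$ is called $L$-small, written $\{Q_i\}\in S(L)$, if $\sum_i|Q_i|\le |Q|/L$. For $q>1$, a functional $Y:\mathcal{Q}\to(0,\infty)$ belongs to $\mathcal{Y}_q$ if there exists $c>0$ such that for every cube $Q$, every $L\ge 1$ and every family $\Lambda$ of pairwise disjoint subcubes of $Q$ with $\Lambda\in S(L)$, $$\sum_{P\in\Lambda}Y(P)\le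 c\,Y(Q)\left(\frac1L\right)^{1/q}.$$ The smallest such constant $c$ is denoted $\beta_Y$. *)

theory Defs
  imports "HOL-Analysis.Analysis"
begin

text \<open>
  Cubes are half-open, so that "pairwise disjoint" can be read literally: a cube is
  partitioned by its dyadic subcubes. This is the same as working with closed cubes
  with pairwise disjoint interiors.
\<close>

definition cubes :: "(real ^ 'n) set set" where
  "cubes = {Q. \<exists>a l. 0 < l \<and> Q = {x. \<forall>i. a $ i \<le> x $ i \<and> x $ i < a $ i + l}}"

definition locally_integrable :: "(real ^ 'n \<Rightarrow> real) \<Rightarrow> bool" where
  "locally_integrable f \<longleftrightarrow> (\<forall>K. compact K \<longrightarrow> set_integrable lebesgue K f)"

definition weight :: "(real ^ 'n \<Rightarrow> real) \<Rightarrow> bool" where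
  "weight w \<longleftrightarrow> locally_integrable w \<and> (\<forall>x. 0 \<le> w x)"

definition weighted_measure :: "(real ^ 'n \<Rightarrow> real) \<Rightarrow> (real ^ 'n) set \<Rightarrow> real" where
  "weighted_measure w Q = (LINT x:Q|lebesgue. w x)"

definition avg :: "(real ^ 'n \<Rightarrow> real) \<Rightarrow> (real ^ 'n) set \<Rightarrow> real" where
  "avg f Q = (LINT x:Q|lebesgue. f x) / measure lebesgue Q"

text \<open>
  The norm takes values in the extended reals and is only meaningful for locally
  integrable functions, for which all the integrals below exist.
\<close>

definition bmo_norm :: "(real ^ 'n \<Rightarrow> real) \<Rightarrow> ennreal" where
  "bmo_norm f = (SUP Q\<in>cubes. ennreal (avg (\<lambda>x. \<bar>f x - avg f Q\<bar>) Q))"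

definition BMO :: "(real ^ 'n \<Rightarrow> real) set" where
  "BMO = {f. locally_integrable f \<and> bmo_norm f < \<infinity>}"

text \<open>
  Families may be infinite. The sums are taken in \<^typ>\<open>ennreal\<close>, where they always
  exist; a divergent real-valued \<^const>\<open>infsum\<close> would be 0.
\<close>

definition small_families :: "real \<Rightarrow> (real ^ 'n) set \<Rightarrow> (real ^ 'n) set set set" where
  "small_families L Q = {\<Lambda>. \<Lambda> \<subseteq> cubes \<and> (\<forall>P\<in>\<Lambda>. P \<subseteq> Q) \<and> disjoint \<Lambda> \<and>
     (\<Sum>\<^sub>\<infinity>P\<in>\<Lambda>. emeasure lebesgue P) \<le> emeasure lebesgue Q / ennreal L}"

definition smallness_bound :: "real \<Rightarrow> ((real ^ 'n) set \<Rightarrow> real) \<Rightarrow> real \<Rightarrow> bool" where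
  "smallness_bound q Y c \<longleftrightarrow> 0 < c \<and>
     (\<forall>Q\<in>cubes. \<forall>L\<ge>1. \<forall>\<Lambda>\<in>small_families L Q.
        (\<Sum>\<^sub>\<infinity>P\<in>\<Lambda>. ennreal (Y P)) \<le> ennreal (c * Y Q * (1 / L) powr (1 / q)))"

text \<open>
  A functional on cubes is a function on all sets of which only the values on cubes matter.
\<close>

definition Y_class :: "real \<Rightarrow> ((real ^ 'n) set \<Rightarrow> real) set" where
  "Y_class q = {Y. (\<forall>Q\<in>cubes. 0 < Y Q) \<and> (\<exists>c. smallness_bound q Y c)}"

definition beta :: "real \<Rightarrow> ((real ^ 'n) set \<Rightarrow> real) \<Rightarrow> real" where
  "beta q Y = Inf {c. smallness_bound q Y c}"

lemma cubes_nonempty: "(cubes :: (real ^ 'n) set set) \<noteq> {}"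
  unfolding cubes_def using zero_less_one by blast

lemma smallness_bound_ge_1:
  fixes Y :: "(real ^ 'n) set \<Rightarrow> real"
  assumes pos: "\<forall>Q\<in>cubes. 0 < Y Q" and c: "smallness_bound q Y c"
  shows "1 \<le> c"
proof -
  obtain Q :: "(real ^ 'n) set" where Q: "Q \<in> cubes"
    using cubes_nonempty by blast
  have "{Q} \<in> small_families 1 Q"
    using Q by (simp add: small_families_def divide_ennreal_def)
  then have "(\<Sum>\<^sub>\<infinity>P\<in>{Q}. ennreal (Y P)) \<le> ennreal (c * Y Q * (1 / 1) powr (1 / q))"
    using c Q unfolding smallness_bound_def by blast
  then have "ennreal (Y Q) \<le> ennreal (c * Y Q)"
    by simp
  then have "Y Q \<le> c * Y Q"
    using pos Q c by (subst (asm) ennreal_le_iff) (auto simp: smallness_bound_def less_imp_le)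
  then show ?thesis
    using pos Q by auto
qed

text \<open>The infimum defining \<^const>\<open>beta\<close> is attained, so it is the smallest admissible constant.\<close>

lemma beta_least:
  fixes Y :: "(real ^ 'n) set \<Rightarrow> real"
  assumes Y: "Y \<in> Y_class q"
  shows "smallness_bound q Y (beta q Y)"
    and "smallness_bound q Y c \<Longrightarrow> beta q Y \<le> c"
proof -
  let ?S = "{c. smallness_bound q Y c}"
  have pos: "\<forall>Q\<in>cubes. 0 < Y Q" and ne: "?S \<noteq> {}"
    using Y by (auto simp: Y_class_def)
  have ge1: "1 \<le> c" if "c \<in> ?S" for c
    using smallness_bound_ge_1[OF pos] that by simp
  have bdd: "bdd_below ?S"
    using ge1 by (rule bdd_belowI)
  show "beta q Y \<le> c" if "smallness_bound q Y c"
    unfolding beta_def using that bdd by (intro cInf_lower) auto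
  have beta1: "1 \<le> beta q Y"
    unfolding beta_def using ne ge1 by (intro cInf_greatest)
  show "smallness_bound q Y (beta q Y)"
    unfolding smallness_bound_def
  proof (intro conjI ballI allI impI)
    show "0 < beta q Y" using beta1 by simp
    fix Q :: "(real ^ 'n) set" and L :: real and \<Lambda>
    assume Q: "Q \<in> cubes" and L: "1 \<le> L" and \<Lambda>: "\<Lambda> \<in> small_families L Q"
    define A where "A = Y Q * (1 / L) powr (1 / q)"
    define s where "s = (\<Sum>\<^sub>\<infinity>P\<in>\<Lambda>. ennreal (Y P))"
    have A: "0 < A"
      using pos Q L by (simp add: A_def)
    have le: "s \<le> ennreal (c * A)" if "c \<in> ?S" for c
      using that Q L \<Lambda> unfolding smallness_bound_def s_def A_def by (simp add: mult.assoc)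
    obtain c0 where c0: "c0 \<in> ?S" using ne by blast
    have "s < \<infinity>"
      using le[OF c0] ennreal_less_top le_less_trans by fastforce
    then obtain r where r: "0 \<le> r" "s = ennreal r"
      by (cases s) auto
    have "r / A \<le> c" if "c \<in> ?S" for c
    proof -
      have "r \<le> c * A"
        using le[OF that] r A ge1[OF that] by (simp add: ennreal_le_iff)
      then show ?thesis using A by (simp add: field_simps)
    qed
    then have "r / A \<le> beta q Y"
      unfolding beta_def using ne by (intro cInf_greatest)
    then have "r \<le> beta q Y * A"
      using A by (simp add: field_simps)
    then show "(\<Sum>\<^sub>\<infinity>P\<in>\<Lambda>. ennreal (Y P)) \<le> ennreal (beta q Y * Y Q * (1 / L) powr (1 / q))"
      using r(2) unfolding s_def A_def by (simp add: mult.assoc ennreal_leI)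
  qed
qed

end

theory Submission
  imports Defs
begin

text \<open>
  The functional enters through a single family of layers. Fix a cube \<open>Q\<close> and let \<open>N\<close>
  exceed the BMO norm of \<open>f\<close>. The Calderon--Zygmund decomposition of \<open>\<bar>f - avg f P\<bar>\<close> at
  height \<open>e N\<close> in a cube \<open>P\<close> selects disjoint subcubes of total measure at most
  \<open>\<bar>P\<bar> / e\<close>. On a selected cube the average of \<open>f\<close> differs from the one on \<open>P\<close> by at most
  \<open>B = 2\<^sup>n e N\<close>, and almost everywhere off the selected cubes \<open>f\<close> itself is that close to
  \<open>avg f P\<close> (\<open>bmo_stopping_cubes\<close>). Repeating this inside every selected cube gives families
  \<open>\<Lambda>\<^sub>0 = {Q}, \<Lambda>\<^sub>1, \<Lambda>\<^sub>2, \<dots>\<close> with decreasing unions \<open>\<Omega>\<^sub>k\<close> such that \<open>\<Lambda>\<^sub>k\<close> is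
  \<open>e\<^sup>k\<close>-small, and \<open>\<bar>f - avg f Q\<bar> \<le> (k + 1) B\<close> almost everywhere on \<open>\<Omega>\<^sub>k - \<Omega>\<^sub>k\<^sub>+\<^sub>1\<close>
  (\<open>bmo_layers\<close>). The hypotheses on \<open>w\<close> and \<open>Y\<close> bound the weight of \<open>\<Omega>\<^sub>k\<close> by the sum of
  \<open>Y\<close> over \<open>\<Lambda>\<^sub>k\<close>, which is at most \<open>\<beta> Y(Q) e\<^bsup>-k/q\<^esup>\<close>.

  It remains to sum over the layers, and here the linear dependence on \<open>q\<close> is at stake:
  bounding the integrand by \<open>((k + 1) B)\<^sup>p\<close> on each layer would give
  \<open>\<Sum> (k + 1)\<^sup>p e\<^bsup>-k/q\<^esup>\<close>, which is of order \<open>q\<^bsup>p+1\<^esup>\<close>, so quadratic in \<open>q\<close> for \<open>p = 1\<close>.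
  Summation by parts saves the factor \<open>q\<close>: one has
  \<open>\<bar>f - avg f Q\<bar>\<^sup>p \<le> B\<^sup>p \<Sum> ((k + 1)\<^sup>p - k\<^sup>p) indicator \<Omega>\<^sub>k\<close> almost everywhere on \<open>Q\<close>,
  and \<open>\<Sum> ((k + 1)\<^sup>p - k\<^sup>p) e\<^bsup>-k/q\<^esup> \<le> e (2 p q)\<^sup>p\<close>
  (\<open>exp_weighted_power_differences_bound\<close>). Taking \<open>p\<close>-th roots, with \<open>\<beta> \<ge> 1\<close>, and letting
  \<open>N\<close> decrease to the norm gives the constant \<open>c = 2 e\<^sup>2 2\<^sup>n\<close>.

  The pointwise bound off the selected cubes is usually taken from Lebesgue's differentiation
  theorem. Here a covering argument suffices: the set where the bound fails is covered by disjoint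
  dyadic cubes inside an open set of nearly the same measure, and on each of these the average is
  under control (\<open>AE_le_of_grid_averages_le\<close>).
\<close>

section \<open>Measures of unions of disjoint families\<close>

lemma infsum_emeasure_disjoint:
  assumes \<Lambda>: "countable \<Lambda>" "disjoint \<Lambda>" "\<Lambda> \<subseteq> sets M"
  shows "(\<Sum>\<^sub>\<infinity>P\<in>\<Lambda>. emeasure M P) = emeasure M (\<Union>\<Lambda>)"
proof (cases "finite \<Lambda>")
  case True
  have "(\<Sum>P\<in>\<Lambda>. emeasure M P) = emeasure M (\<Union>P\<in>\<Lambda>. P)"
    using True \<Lambda> by (intro sum_emeasure) (auto simp: disjoint_family_on_def disjoint_def)
  then show ?thesis using True by simp
next
  case False
  define e where "e = from_nat_into \<Lambda>"
  have e: "bij_betw e UNIV \<Lambda>"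
    using False \<Lambda> by (simp add: e_def bij_betw_from_nat_into)
  have ran: "range e = \<Lambda>" and inj: "inj e"
    using e by (auto simp: bij_betw_def)
  have "disjoint_family e"
    unfolding disjoint_family_on_def
    using \<Lambda>(2) inj ran by (metis disjointD injD rangeI)
  then have "(\<Sum>n. emeasure M (e n)) = emeasure M (\<Union>\<Lambda>)"
    using \<Lambda> ran by (subst suminf_emeasure) auto
  moreover have "infsum (\<lambda>n. emeasure M (e n)) UNIV = (\<Sum>n. emeasure M (e n))"
    by (intro sums_unique has_sum_imp_sums has_sum_infsum nonneg_summable_on_complete) simp
  moreover have "infsum (\<lambda>n. emeasure M (e n)) UNIV = (\<Sum>\<^sub>\<infinity>P\<in>\<Lambda>. emeasure M P)"
    using e by (rule infsum_reindex_bij_betw)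
  ultimately show ?thesis by simp
qed

text \<open>
  Comparisons on the single cubes of a family add up. In the applications one of the two
  measures is a constant multiple of Lebesgue measure and the other has a density.
\<close>

lemma emeasure_Union_mono_disjoint:
  assumes \<Lambda>: "countable \<Lambda>" "disjoint \<Lambda>" "\<Lambda> \<subseteq> sets M" and N: "sets N = sets M"
    and le: "\<And>P. P \<in> \<Lambda> \<Longrightarrow> emeasure M P \<le> emeasure N P"
  shows "emeasure M (\<Union>\<Lambda>) \<le> emeasure N (\<Union>\<Lambda>)"
proof -
  have "(\<Sum>\<^sub>\<infinity>P\<in>\<Lambda>. emeasure M P) \<le> (\<Sum>\<^sub>\<infinity>P\<in>\<Lambda>. emeasure N P)"
    using le by (intro infsum_mono nonneg_summable_on_complete) auto
  then show ?thesis
    using infsum_emeasure_disjoint[of \<Lambda> M] infsum_emeasure_disjoint[of \<Lambda> N] \<Lambda> N by simp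
qed

section \<open>Dyadic grids\<close>

definition cube :: "real ^ 'n \<Rightarrow> real \<Rightarrow> (real ^ 'n) set" where
  "cube a l = {x. \<forall>i. a $ i \<le> x $ i \<and> x $ i < a $ i + l}"

lemma cubes_iff: "Q \<in> cubes \<longleftrightarrow> (\<exists>a l. 0 < l \<and> Q = cube a l)"
  by (simp add: cubes_def cube_def)

lemma
  fixes a :: "real ^ 'n"
  assumes l: "0 < l"
  shows sets_cube: "cube a l \<in> sets lebesgue"
    and emeasure_cube: "emeasure lebesgue (cube a l) = ennreal (l ^ CARD('n))"
proof -
  define b where "b = (\<chi> i. a $ i + l)"
  have "cube a l = (\<Inter>i. {x. a $ i \<le> x $ i} \<inter> {x. x $ i < a $ i + l})"
    by (auto simp: cube_def)
  also have "\<dots> \<in> sets borel" by measurable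
  finally have cb: "cube a l \<in> sets borel" .
  then show "cube a l \<in> sets lebesgue" by simp
  have bo: "emeasure lborel (box a b) = emeasure lborel (cbox a b)"
    by (simp add: emeasure_lborel_box_eq emeasure_lborel_cbox_eq)
  have sub: "box a b \<subseteq> cube a l" "cube a l \<subseteq> cbox a b"
    by (auto simp: cube_def b_def mem_box_cart less_imp_le)
  have "emeasure lborel (cube a l) = emeasure lborel (cbox a b)"
    using emeasure_mono[OF sub(1), of lborel] emeasure_mono[OF sub(2), of lborel] bo cb by auto
  also have "\<dots> = ennreal (measure lborel (cbox a b))"
    using emeasure_lborel_cbox_finite[of a b] by (intro emeasure_eq_ennreal_measure) auto
  also have "measure lborel (cbox a b) = (\<Prod>i\<in>UNIV. b $ i - a $ i)"
    using l by (intro content_cbox_cart) (auto simp: interval_ne_empty_cart b_def less_imp_le)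
  finally show "emeasure lebesgue (cube a l) = ennreal (l ^ CARD('n))"
    using cb by (simp add: b_def)
qed

lemma sets_cubes: "Q \<in> cubes \<Longrightarrow> Q \<in> sets lebesgue"
  using sets_cube cubes_iff by metis

lemma emeasure_cubes:
  fixes Q :: "(real ^ 'n) set"
  assumes "Q \<in> cubes"
  shows "0 < measure lebesgue Q" "emeasure lebesgue Q = ennreal (measure lebesgue Q)"
proof -
  obtain a l where Q: "0 < l" "Q = cube a l" using assms cubes_iff by blast
  have m: "measure lebesgue Q = l ^ CARD('n)"
    using Q unfolding measure_def by (simp add: emeasure_cube)
  show "0 < measure lebesgue Q" "emeasure lebesgue Q = ennreal (measure lebesgue Q)"
    using Q unfolding m by (simp_all add: emeasure_cube)
qed

lemma countable_disjoint_cubes: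
  assumes "\<Lambda> \<subseteq> (cubes :: (real ^ 'n) set set)" "disjoint \<Lambda>"
  shows "countable \<Lambda>"
proof -
  have int: "interior R \<noteq> {}" if "R \<in> \<Lambda>" for R
  proof -
    have "R \<in> cubes" using that assms(1) by auto
    then obtain a l where R: "0 < l" "R = cube a l" using cubes_iff by metis
    define b where "b = (\<chi> i. a $ i + l)"
    have "box a b \<subseteq> interior R"
      by (rule interior_maximal) (auto simp: R cube_def b_def mem_box_cart less_imp_le)
    moreover have "(\<chi> i. a $ i + l / 2) \<in> box a b"
      using R by (auto simp: b_def mem_box_cart)
    ultimately show ?thesis by auto
  qed
  have dis: "R \<inter> R' = {}" if "R \<in> \<Lambda>" "R' \<in> \<Lambda>" "R \<noteq> R'" for R R'
    using assms(2) that by (auto simp: disjoint_def)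
  have dis_int: "interior R \<inter> interior R' = {}" if "R \<in> \<Lambda>" "R' \<in> \<Lambda>" "R \<noteq> R'" for R R'
    using dis[OF that] by (metis interior_Int interior_empty)
  \<comment> \<open>The interiors form a disjoint family of nonempty open sets.\<close>
  have "inj_on interior \<Lambda>"
  proof (rule inj_onI, rule ccontr)
    fix R R' assume "R \<in> \<Lambda>" "R' \<in> \<Lambda>" "interior R = interior R'" "R \<noteq> R'"
    then show False using dis_int[of R R'] int[of R] by simp
  qed
  moreover have "countable (interior ` \<Lambda>)"
  proof (rule countable_disjoint_open_subsets)
    show "pairwise disjnt (interior ` \<Lambda>)"
      unfolding pairwise_def disjnt_def using dis_int by blast
  qed auto
  ultimately show ?thesis by (rule countable_image_inj_on[rotated])
qed

text \<open>
  The half-open dyadic cube of generation \<open>k\<close> that contains \<open>x\<close>, for the grid generated by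
  \<open>cube a l\<close>. It is written as a class of the relation "same coordinatewise floor", so that the
  cubes of one generation partition the space by definition.
\<close>

definition grid :: "real ^ 'n \<Rightarrow> real \<Rightarrow> nat \<Rightarrow> real ^ 'n \<Rightarrow> (real ^ 'n) set" where
  "grid a l k x = {y. \<forall>i. \<lfloor>2 ^ k * (y $ i - a $ i) / l\<rfloor> = \<lfloor>2 ^ k * (x $ i - a $ i) / l\<rfloor>}"

lemma self_in_grid: "x \<in> grid a l k x"
  by (simp add: grid_def)

lemma grid_eq: "y \<in> grid a l k x \<Longrightarrow> grid a l k y = grid a l k x"
  by (simp add: grid_def)

lemma grid_nested_Suc: "grid a l (Suc k) x \<subseteq> grid a l k x"
proof
  fix y assume y: "y \<in> grid a l (Suc k) x"
  have half: "\<lfloor>t\<rfloor> = \<lfloor>2 * t\<rfloor> div 2" for t :: real by linarith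
  have "\<lfloor>2 * (2 ^ k * (y $ i - a $ i) / l)\<rfloor> = \<lfloor>2 * (2 ^ k * (x $ i - a $ i) / l)\<rfloor>" for i
    using y by (simp add: grid_def mult.assoc)
  then have "\<lfloor>2 ^ k * (y $ i - a $ i) / l\<rfloor> = \<lfloor>2 ^ k * (x $ i - a $ i) / l\<rfloor>" for i
    using half by metis
  then show "y \<in> grid a l k x" by (simp add: grid_def)
qed

lemma grid_nested: "j \<le> k \<Longrightarrow> grid a l k x \<subseteq> grid a l j x"
  by (rule lift_Suc_antimono_le) (rule grid_nested_Suc)

lemma grid_eq_cube:
  assumes l: "0 < l"
  shows "grid a l k x = cube (\<chi> i. a $ i + l * real_of_int \<lfloor>2 ^ k * (x $ i - a $ i) / l\<rfloor> / 2 ^ k) (l / 2 ^ k)"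
  using l by (auto simp: grid_def cube_def floor_eq_iff field_simps)

lemma grid_in_cubes: "0 < l \<Longrightarrow> grid a l k x \<in> cubes"
  using grid_eq_cube[of l a k x] by (auto simp: cubes_iff intro!: exI[of _ "l / 2 ^ k"])

lemma emeasure_grid_parent:
  fixes a :: "real ^ 'n"
  assumes l: "0 < l"
  shows "emeasure lebesgue (grid a l k x) = 2 ^ CARD('n) * emeasure lebesgue (grid a l (Suc k) x)"
proof -
  have "emeasure lebesgue (grid a l k x) = ennreal (2 ^ CARD('n) * (l / 2 ^ Suc k) ^ CARD('n))"
    using l by (simp add: grid_eq_cube emeasure_cube power_divide power_mult_distrib)
  also have "\<dots> = ennreal (2 ^ CARD('n)) * ennreal ((l / 2 ^ Suc k) ^ CARD('n))"
    using l by (intro ennreal_mult) auto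
  also have "ennreal ((l / 2 ^ Suc k) ^ CARD('n)) = emeasure lebesgue (grid a l (Suc k) x)"
    using l by (subst grid_eq_cube) (auto simp: emeasure_cube)
  finally show ?thesis by (simp flip: ennreal_power)
qed

lemma grid_0:
  assumes "0 < l" "x \<in> cube a l"
  shows "grid a l 0 x = cube a l"
proof -
  have "\<lfloor>(x $ i - a $ i) / l\<rfloor> = 0" for i
    using assms by (auto simp: cube_def floor_eq_iff field_simps)
  then show ?thesis using assms(1) by (subst grid_eq_cube) (auto simp: vec_lambda_eta)
qed

lemma grid_subset_open:
  fixes a :: "real ^ 'n"
  assumes l: "0 < l" and U: "open U" "x \<in> U"
  shows "\<exists>k. grid a l k x \<subseteq> U"
proof -
  obtain e where e: "0 < e" "ball x e \<subseteq> U" using U open_contains_ball by blast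
  obtain k where k: "(1 / 2 :: real) ^ k < e / (real CARD('n) * l)"
    using real_arch_pow_inv[of "e / (real CARD('n) * l)" "1/2"] e l by auto
  have "grid a l k x \<subseteq> ball x e"
  proof
    fix y assume y: "y \<in> grid a l k x"
    have "\<bar>x $ i - y $ i\<bar> \<le> l / 2 ^ k" for i
    proof -
      have "\<lfloor>2 ^ k * (y $ i - a $ i) / l\<rfloor> = \<lfloor>2 ^ k * (x $ i - a $ i) / l\<rfloor>"
        using y by (simp add: grid_def)
      then have "\<bar>2 ^ k * (x $ i - a $ i) / l - 2 ^ k * (y $ i - a $ i) / l\<bar> \<le> 1"
        by linarith
      also have "2 ^ k * (x $ i - a $ i) / l - 2 ^ k * (y $ i - a $ i) / l = (x $ i - y $ i) * (2 ^ k / l)"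
        by (simp add: algebra_simps diff_divide_distrib)
      finally have "\<bar>x $ i - y $ i\<bar> * (2 ^ k / l) \<le> 1" using l by (simp add: abs_mult)
      then show ?thesis using l by (simp add: field_simps)
    qed
    then have "(\<Sum>i\<in>UNIV. \<bar>(x - y) $ i\<bar>) \<le> (\<Sum>i\<in>(UNIV::'n set). l / 2 ^ k)"
      by (intro sum_mono) auto
    then have "norm (x - y) \<le> real CARD('n) * (l / 2 ^ k)"
      using norm_le_l1_cart[of "x - y"] by simp
    also have "\<dots> < e" using k l by (simp add: field_simps power_one_over)
    finally show "y \<in> ball x e" by (simp add: dist_norm)
  qed
  then show ?thesis using e by blast
qed

text \<open>
  Starting from the largest scale, stop at each point of \<open>A\<close> at the first cube with the
  property \<open>p\<close>. If two of the selected cubes meet, then the larger one is an ancestor of the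
  smaller one; as it has the property \<open>p\<close>, the smaller one can only be the same cube.
\<close>

lemma maximal_grid_cubes:
  fixes a :: "real ^ 'n"
  assumes l: "0 < l" and A: "\<And>x. x \<in> A \<Longrightarrow> \<exists>k. p (grid a l k x)"
  obtains \<Lambda> where "\<Lambda> \<subseteq> cubes" "disjoint \<Lambda>" "A \<subseteq> \<Union>\<Lambda>"
    "\<forall>R\<in>\<Lambda>. \<exists>x\<in>A. \<exists>k. R = grid a l k x \<and> p R \<and> (\<forall>j<k. \<not> p (grid a l j x))"
proof
  define K where "K x = (LEAST k. p (grid a l k x))" for x
  define \<Lambda> where "\<Lambda> = (\<lambda>x. grid a l (K x) x) ` A"
  have K: "p (grid a l (K x) x)" "\<And>j. j < K x \<Longrightarrow> \<not> p (grid a l j x)" if "x \<in> A" for x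
    using A[OF that] unfolding K_def by (auto intro: LeastI dest: not_less_Least)
  show "\<Lambda> \<subseteq> cubes" using grid_in_cubes[OF l] by (auto simp: \<Lambda>_def)
  show "A \<subseteq> \<Union>\<Lambda>" unfolding \<Lambda>_def using self_in_grid by blast
  show "\<forall>R\<in>\<Lambda>. \<exists>x\<in>A. \<exists>k. R = grid a l k x \<and> p R \<and> (\<forall>j<k. \<not> p (grid a l j x))"
    using K unfolding \<Lambda>_def by blast
  have eq: "grid a l (K x) x = grid a l (K y) y"
    if "x \<in> A" "y \<in> A" "z \<in> grid a l (K x) x" "z \<in> grid a l (K y) y" "K x \<le> K y" for x y z
  proof -
    have same: "grid a l j x = grid a l j y" if "j \<le> K x" for j
    proof -
      have "z \<in> grid a l j x" "z \<in> grid a l j y"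
        using grid_nested[of j "K x" a l x] grid_nested[of j "K y" a l y] that
          \<open>z \<in> grid a l (K x) x\<close> \<open>z \<in> grid a l (K y) y\<close> \<open>K x \<le> K y\<close> by auto
      then show ?thesis using grid_eq by metis
    qed
    have "\<not> K x < K y" using K(1)[OF that(1)] K(2)[OF that(2)] same[of "K x"] by auto
    then have "K x = K y" using that(5) by simp
    then show ?thesis using same[of "K x"] by simp
  qed
  show "disjoint \<Lambda>"
  proof (rule disjointI)
    fix R R' assume "R \<in> \<Lambda>" "R' \<in> \<Lambda>" "R \<noteq> R'"
    then obtain x y where xy: "x \<in> A" "y \<in> A" "R = grid a l (K x) x" "R' = grid a l (K y) y"
      by (auto simp: \<Lambda>_def)
    show "R \<inter> R' = {}"
    proof (rule ccontr)
      assume "R \<inter> R' \<noteq> {}"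
      then obtain z where "z \<in> grid a l (K x) x" "z \<in> grid a l (K y) y" using xy by auto
      then show False
        using eq[of x y z] eq[of y x z] xy \<open>R \<noteq> R'\<close> linear[of "K x" "K y"] by auto
    qed
  qed
qed

section \<open>The Calderon--Zygmund decomposition\<close>

text \<open>
  A substitute for the differentiation theorem. Let \<open>F\<close> be the part of \<open>E\<close> where \<open>g > t\<close>.
  Maximal grid cubes inside an open \<open>U \<supseteq> F\<close>, each containing a point of \<open>F\<close>, cover \<open>F\<close>, and
  the average of \<open>g\<close> on each is at most \<open>t\<close>; hence the integral of \<open>g\<close> over \<open>F\<close> is at most
  \<open>t \<bar>U\<bar>\<close>. As \<open>\<bar>U\<bar>\<close> tends to \<open>\<bar>F\<bar>\<close>, the integral of \<open>g - t > 0\<close> over \<open>F\<close> turns out to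
  be \<open>0\<close>.
\<close>

lemma AE_le_of_grid_averages_le:
  fixes g :: "real ^ 'n \<Rightarrow> ennreal" and t :: real
  assumes l: "0 < l" and t: "0 \<le> t" and g [measurable]: "g \<in> borel_measurable lebesgue"
    and E [measurable]: "E \<in> sets lebesgue" and fin: "emeasure lebesgue E < \<infinity>"
    and avg: "\<And>x k. x \<in> E \<Longrightarrow>
      emeasure (density lebesgue g) (grid a l k x) \<le> ennreal t * emeasure lebesgue (grid a l k x)"
  shows "AE x in lebesgue. x \<in> E \<longrightarrow> g x \<le> ennreal t"
proof -
  let ?\<nu> = "density lebesgue g" and ?\<mu> = "density lebesgue (\<lambda>_. ennreal t)"
  define F where "F = {x \<in> E. ennreal t < g x}"
  have "F = E \<inter> {x \<in> space lebesgue. ennreal t < g x}" by (auto simp: F_def)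
  also have "\<dots> \<in> sets lebesgue" by measurable
  finally have F [measurable]: "F \<in> sets lebesgue" .
  have "emeasure lebesgue F \<le> emeasure lebesgue E"
    by (rule emeasure_mono) (auto simp: F_def)
  then have finF: "emeasure lebesgue F < \<infinity>" using fin by (rule le_less_trans)
  have "emeasure ?\<nu> F \<le> ennreal t * emeasure lebesgue F"
  proof (rule ennreal_le_epsilon)
    fix e :: real assume e: "0 < e"
    \<comment> \<open>\<open>t + 1\<close> and not \<open>t\<close>, because \<open>t\<close> may be \<open>0\<close>\<close>
    define d where "d = e / (t + 1)"
    have d: "0 < d" "t * d \<le> e" using e t by (auto simp: d_def field_simps)
    obtain U where U: "open U" "F \<subseteq> U" "emeasure lebesgue (U - F) < ennreal d"
      using sets_lebesgue_outer_open[OF F d(1)] by metis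
    have Us [measurable]: "U \<in> sets lebesgue" using U(1) by simp
    obtain \<Lambda> where \<Lambda>: "\<Lambda> \<subseteq> cubes" "disjoint \<Lambda>" "F \<subseteq> \<Union>\<Lambda>"
      and R: "\<forall>R\<in>\<Lambda>. \<exists>x\<in>F. \<exists>k. R = grid a l k x \<and> R \<subseteq> U \<and> (\<forall>j<k. \<not> grid a l j x \<subseteq> U)"
    proof (rule maximal_grid_cubes[OF l, of F "\<lambda>R. R \<subseteq> U"])
      show "\<exists>k. grid a l k x \<subseteq> U" if "x \<in> F" for x
        using grid_subset_open[OF l U(1)] U(2) that by blast
    qed (rule that)
    have cnt: "countable \<Lambda>" using \<Lambda> by (intro countable_disjoint_cubes)
    have sets: "\<Lambda> \<subseteq> sets lebesgue" using \<Lambda> sets_cubes by auto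
    then have Us': "\<Union>\<Lambda> \<in> sets lebesgue" using cnt by (intro sets.countable_Union)
    have "emeasure ?\<nu> F \<le> emeasure ?\<nu> (\<Union>\<Lambda>)"
      using \<Lambda>(3) Us' by (intro emeasure_mono) auto
    also have "\<dots> \<le> emeasure ?\<mu> (\<Union>\<Lambda>)"
    proof (rule emeasure_Union_mono_disjoint)
      fix P assume "P \<in> \<Lambda>"
      then obtain x k where "x \<in> F" "P = grid a l k x" using bspec[OF R \<open>P \<in> \<Lambda>\<close>] by metis
      then show "emeasure ?\<nu> P \<le> emeasure ?\<mu> P"
        using avg[of x k] \<open>P \<in> \<Lambda>\<close> sets by (auto simp: emeasure_density_const F_def)
    qed (use cnt \<Lambda> sets in auto)
    also have "\<dots> = ennreal t * emeasure lebesgue (\<Union>\<Lambda>)"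
      using Us' by (intro emeasure_density_const)
    also have "\<dots> \<le> ennreal t * emeasure lebesgue (F \<union> (U - F))"
    proof (intro mult_left_mono emeasure_mono)
      show "\<Union>\<Lambda> \<subseteq> F \<union> (U - F)" using bspec[OF R] by fast
    qed auto
    also have "\<dots> \<le> ennreal t * (emeasure lebesgue F + emeasure lebesgue (U - F))"
      by (intro mult_left_mono emeasure_subadditive) auto
    also have "\<dots> \<le> ennreal t * (emeasure lebesgue F + ennreal d)"
      using U(3) by (intro mult_left_mono add_left_mono) auto
    also have "\<dots> = ennreal t * emeasure lebesgue F + ennreal (t * d)"
      using t d by (simp add: distrib_left ennreal_mult)
    also have "\<dots> \<le> ennreal t * emeasure lebesgue F + ennreal e"
      using d by (intro add_left_mono ennreal_leI)
    finally show "emeasure ?\<nu> F \<le> ennreal t * emeasure lebesgue F + ennreal e" .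
  qed
  define I where "I = (\<integral>\<^sup>+x. (g x - ennreal t) * indicator F x \<partial>lebesgue)"
  have "I + ennreal t * emeasure lebesgue F
      = (\<integral>\<^sup>+x. (g x - ennreal t) * indicator F x + ennreal t * indicator F x \<partial>lebesgue)"
    unfolding I_def by (subst nn_integral_add) (auto simp: nn_integral_cmult_indicator)
  also have "\<dots> = emeasure ?\<nu> F"
    by (subst emeasure_density)
      (auto intro!: nn_integral_cong simp: F_def indicator_def diff_add_cancel_ennreal less_imp_le)
  also have "\<dots> \<le> ennreal t * emeasure lebesgue F" by fact
  finally have le: "I + ennreal t * emeasure lebesgue F \<le> ennreal t * emeasure lebesgue F" .
  have "ennreal t * emeasure lebesgue F < top"
    using finF by (simp add: ennreal_mult_less_top)
  then obtain b where "0 \<le> b" "ennreal t * emeasure lebesgue F = ennreal b"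
    by (cases "ennreal t * emeasure lebesgue F") auto
  then have "I = 0"
    using le by (cases I) (auto simp flip: ennreal_plus simp: top_unique)
  then have "AE x in lebesgue. (g x - ennreal t) * indicator F x = 0"
    unfolding I_def by (subst (asm) nn_integral_0_iff_AE) auto
  then show ?thesis
  proof eventually_elim
    case (elim x)
    show ?case
    proof
      assume "x \<in> E"
      show "g x \<le> ennreal t"
      proof (rule ccontr)
        assume "\<not> g x \<le> ennreal t"
        then have "x \<in> F" "ennreal t < g x" using \<open>x \<in> E\<close> by (auto simp: F_def)
        then have "g x - ennreal t = 0" using elim by simp
        then show False
          using \<open>ennreal t < g x\<close> diff_gt_0_iff_gt_ennreal[of "g x" "ennreal t"] by simp
      qed
    qed
  qed
qed

text \<open>
  The selected cubes are the maximal grid cubes inside \<open>Q\<close> on which the average of \<open>g\<close> exceeds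
  \<open>t\<close>. By hypothesis \<open>Q\<close> itself is not selected, so every selected cube has a parent with
  average at most \<open>t\<close>; since the parent is \<open>2\<^sup>n\<close> times as large, this gives the upper bound on
  the selected cube. At the remaining points all grid averages are at most \<open>t\<close>.
\<close>

lemma calderon_zygmund:
  fixes g :: "real ^ 'n \<Rightarrow> ennreal" and t :: real
  assumes Q: "Q \<in> cubes" and t: "0 \<le> t" and g [measurable]: "g \<in> borel_measurable lebesgue"
    and avg: "emeasure (density lebesgue g) Q \<le> ennreal t * emeasure lebesgue Q"
  obtains \<Lambda> where "\<Lambda> \<subseteq> cubes" "disjoint \<Lambda>" "\<And>R. R \<in> \<Lambda> \<Longrightarrow> R \<subseteq> Q"
    "\<And>R. R \<in> \<Lambda> \<Longrightarrow> ennreal t * emeasure lebesgue R \<le> emeasure (density lebesgue g) R"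
    "\<And>R. R \<in> \<Lambda> \<Longrightarrow> emeasure (density lebesgue g) R \<le> ennreal (2 ^ CARD('n) * t) * emeasure lebesgue R"
    "AE x in lebesgue. x \<in> Q - \<Union>\<Lambda> \<longrightarrow> g x \<le> ennreal t"
proof -
  let ?\<nu> = "density lebesgue g"
  obtain a l where l: "0 < l" and Qc: "Q = cube a l" using Q cubes_iff by metis
  define p where "p R \<longleftrightarrow> ennreal t * emeasure lebesgue R < emeasure ?\<nu> R" for R
  define A where "A = {x \<in> Q. \<exists>k. p (grid a l k x)}"
  obtain \<Lambda> where \<Lambda>: "\<Lambda> \<subseteq> cubes" "disjoint \<Lambda>" "A \<subseteq> \<Union>\<Lambda>"
    and R: "\<forall>R\<in>\<Lambda>. \<exists>x\<in>A. \<exists>k. R = grid a l k x \<and> p R \<and> (\<forall>j<k. \<not> p (grid a l j x))"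
  proof (rule maximal_grid_cubes[OF l, of A p])
    show "\<exists>k. p (grid a l k x)" if "x \<in> A" for x using that A_def by blast
  qed (rule that)
  have sets: "\<Lambda> \<subseteq> sets lebesgue" using \<Lambda> sets_cubes by auto
  have g0: "grid a l 0 x = Q" if "x \<in> Q" for x using grid_0[OF l] that Qc by metis
  show ?thesis
  proof
    show "R \<subseteq> Q" if R': "R \<in> \<Lambda>" for R
    proof -
      obtain x k where "x \<in> A" "R = grid a l k x" using bspec[OF R R'] by metis
      then show ?thesis using grid_nested[of 0 k a l x] g0[of x] by (simp add: A_def)
    qed
    show "ennreal t * emeasure lebesgue R \<le> emeasure ?\<nu> R" if R': "R \<in> \<Lambda>" for R
      using R R' p_def less_imp_le by blast
    show "emeasure ?\<nu> R \<le> ennreal (2 ^ CARD('n) * t) * emeasure lebesgue R" if R': "R \<in> \<Lambda>" for R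
    proof -
      obtain x k where x: "x \<in> A" "R = grid a l k x" "p R" "\<forall>j<k. \<not> p (grid a l j x)"
        using bspec[OF R R'] by metis
      have "k \<noteq> 0"
      proof
        assume "k = 0"
        then have "R = Q" using x g0[of x] by (simp add: A_def)
        then show False using x(3) avg by (simp add: p_def not_less)
      qed
      then obtain j where j: "k = Suc j" by (cases k) auto
      have "emeasure ?\<nu> R \<le> emeasure ?\<nu> (grid a l j x)"
        unfolding x(2) j using grid_in_cubes[OF l, of a j x] sets_cubes
        by (intro emeasure_mono grid_nested_Suc) auto
      also have "\<dots> \<le> ennreal t * emeasure lebesgue (grid a l j x)"
        using x(4) j by (auto simp: p_def not_less)
      also have "\<dots> = ennreal t * (ennreal (2 ^ CARD('n)) * emeasure lebesgue R)"
        unfolding x(2) j by (subst emeasure_grid_parent[OF l]) (simp flip: ennreal_power)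
      also have "\<dots> = ennreal (2 ^ CARD('n) * t) * emeasure lebesgue R"
        using t by (subst ennreal_mult) (auto simp: ac_simps)
      finally show ?thesis .
    qed
    have Us: "\<Union>\<Lambda> \<in> sets lebesgue"
      using \<Lambda> sets countable_disjoint_cubes by (intro sets.countable_Union) auto
    show "AE x in lebesgue. x \<in> Q - \<Union>\<Lambda> \<longrightarrow> g x \<le> ennreal t"
    proof (rule AE_le_of_grid_averages_le[OF l t g])
      show QU: "Q - \<Union>\<Lambda> \<in> sets lebesgue" using Us sets_cubes[OF Q] by auto
      have "emeasure lebesgue (Q - \<Union>\<Lambda>) \<le> emeasure lebesgue Q"
        using sets_cubes[OF Q] by (intro emeasure_mono) auto
      then show "emeasure lebesgue (Q - \<Union>\<Lambda>) < \<infinity>"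
        using emeasure_cubes[OF Q] by (simp add: le_less_trans)
      show "emeasure ?\<nu> (grid a l k x) \<le> ennreal t * emeasure lebesgue (grid a l k x)"
        if x: "x \<in> Q - \<Union>\<Lambda>" for x k
      proof -
        have "x \<notin> A" using x \<Lambda>(3) by auto
        then have "\<not> p (grid a l k x)" using x unfolding A_def by auto
        then show ?thesis by (simp add: p_def not_less)
      qed
    qed
  qed (use \<Lambda> in auto)
qed

section \<open>Averages and mean oscillation\<close>

lemma borel_measurable_of_locally_integrable:
  fixes f :: "real ^ 'n \<Rightarrow> real"
  assumes "locally_integrable f"
  shows "f \<in> borel_measurable lebesgue"
proof (rule borel_measurable_LIMSEQ_real)
  fix x :: "real ^ 'n"
  obtain m :: nat where "norm x < real m" using reals_Archimedean2 by blast
  then have "eventually (\<lambda>n. indicator (cball 0 (real n)) x *\<^sub>R f x = f x) sequentially"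
    unfolding eventually_sequentially by (intro exI[of _ m]) auto
  then show "(\<lambda>n. indicator (cball 0 (real n)) x *\<^sub>R f x) \<longlonglongrightarrow> f x"
    by (rule tendsto_eventually)
next
  fix n :: nat
  have "set_integrable lebesgue (cball 0 (real n)) f"
    using assms by (simp add: locally_integrable_def)
  then show "(\<lambda>x. indicator (cball 0 (real n)) x *\<^sub>R f x) \<in> borel_measurable lebesgue"
    unfolding set_integrable_def by (rule borel_measurable_integrable)
qed

lemma set_integrable_cubes:
  fixes f :: "real ^ 'n \<Rightarrow> real"
  assumes "locally_integrable f" "Q \<in> cubes"
  shows "set_integrable lebesgue Q f"
proof -
  obtain a l where Q: "Q = cube a l" using assms cubes_iff by metis
  have sub: "Q \<subseteq> cbox a (\<chi> i. a $ i + l)"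
    by (auto simp: Q cube_def mem_box_cart less_imp_le)
  have "set_integrable lebesgue (cbox a (\<chi> i. a $ i + l)) f"
    using assms by (simp add: locally_integrable_def)
  then show ?thesis
    using sets_cubes[OF assms(2)] sub by (rule set_integrable_subset)
qed

lemma locally_integrable_abs_diff_const:
  fixes f :: "real ^ 'n \<Rightarrow> real"
  assumes "locally_integrable f"
  shows "locally_integrable (\<lambda>x. \<bar>f x - c\<bar>)"
  unfolding locally_integrable_def
proof (intro allI impI)
  fix K :: "(real ^ 'n) set" assume K: "compact K"
  then have "K \<in> lmeasurable" by (rule lmeasurable_compact)
  then have "set_integrable lebesgue K (\<lambda>_. c)"
    unfolding set_integrable_def by (auto intro!: integrable_scaleR_left simp: fmeasurable_def)
  then show "set_integrable lebesgue K (\<lambda>x. \<bar>f x - c\<bar>)"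
    using assms K by (intro set_integrable_abs set_integral_diff) (auto simp: locally_integrable_def)
qed

lemma emeasure_density_cubes:
  fixes g :: "real ^ 'n \<Rightarrow> real"
  assumes g: "locally_integrable g" "\<And>x. 0 \<le> g x" and Q: "Q \<in> cubes"
  shows "emeasure (density lebesgue (\<lambda>x. ennreal (g x))) Q = ennreal (LINT x:Q|lebesgue. g x)"
proof -
  have [measurable]: "g \<in> borel_measurable lebesgue"
    using g by (intro borel_measurable_of_locally_integrable)
  have "emeasure (density lebesgue (\<lambda>x. ennreal (g x))) Q
      = (\<integral>\<^sup>+x. ennreal (indicator Q x *\<^sub>R g x) \<partial>lebesgue)"
    using sets_cubes[OF Q]
    by (subst emeasure_density) (auto intro!: nn_integral_cong simp: indicator_def)
  also have "\<dots> = ennreal (\<integral>x. indicator Q x *\<^sub>R g x \<partial>lebesgue)"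
    using set_integrable_cubes[OF g(1) Q] g(2)
    by (intro nn_integral_eq_integral) (auto simp: set_integrable_def)
  finally show ?thesis by (simp add: set_lebesgue_integral_def)
qed

lemma abs_avg_diff_le:
  fixes f :: "real ^ 'n \<Rightarrow> real"
  assumes f: "locally_integrable f" and R: "R \<in> cubes"
  shows "\<bar>avg f R - c\<bar> \<le> avg (\<lambda>x. \<bar>f x - c\<bar>) R"
proof -
  let ?m = "measure lebesgue R"
  have m: "0 < ?m" using emeasure_cubes[OF R] by simp
  have c: "locally_integrable (\<lambda>_ :: real ^ 'n. c)"
    unfolding locally_integrable_def set_integrable_def
    by (auto intro!: integrable_scaleR_left dest!: lmeasurable_compact simp: fmeasurable_def)
  have "(LINT x:R|lebesgue. c) = ?m * c"
    using emeasure_cubes[OF R] sets_cubes[OF R] by (simp add: set_lebesgue_integral_def)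
  then have "avg f R - c = (LINT x:R|lebesgue. f x - c) / ?m"
    using m set_integral_diff(2)[OF set_integrable_cubes[OF f R] set_integrable_cubes[OF c R]]
    by (simp add: avg_def field_simps)
  moreover have "\<bar>LINT x:R|lebesgue. f x - c\<bar> \<le> (LINT x:R|lebesgue. \<bar>f x - c\<bar>)"
    unfolding set_lebesgue_integral_def
    by (rule order_trans[OF integral_abs_bound]) (auto simp: abs_mult)
  ultimately show ?thesis
    using m by (simp add: avg_def abs_divide divide_right_mono)
qed

lemma avg_abs_diff_le_bmo_norm:
  assumes f: "f \<in> BMO" and N: "enn2real (bmo_norm f) \<le> N" and Q: "Q \<in> cubes"
  shows "avg (\<lambda>x. \<bar>f x - avg f Q\<bar>) Q \<le> N"
proof -
  have "ennreal (avg (\<lambda>x. \<bar>f x - avg f Q\<bar>) Q) \<le> bmo_norm f"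
    unfolding bmo_norm_def using Q by (rule SUP_upper)
  also have "bmo_norm f = ennreal (enn2real (bmo_norm f))"
    using f by (simp add: BMO_def)
  finally show ?thesis
    using N by (metis enn2real_nonneg ennreal_le_iff order_trans)
qed

section \<open>Iterated stopping cubes\<close>

text \<open>
  The decomposition of \<open>\<bar>f - avg f Q\<bar>\<close> at height \<open>L N\<close>. Its average over \<open>Q\<close> is at most
  \<open>N\<close>, a factor \<open>L\<close> below the height; this makes the selected cubes \<open>L\<close>-small.
\<close>

lemma bmo_stopping_cubes:
  fixes f :: "real ^ 'n \<Rightarrow> real"
  assumes f: "f \<in> BMO" and N: "enn2real (bmo_norm f) \<le> N" "0 < N" and L: "1 \<le> L"
    and Q: "Q \<in> cubes"
  shows "\<exists>\<Lambda>. \<Lambda> \<subseteq> cubes \<and> disjoint \<Lambda> \<and> (\<forall>R\<in>\<Lambda>. R \<subseteq> Q) \<and>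
    emeasure lebesgue (\<Union>\<Lambda>) \<le> ennreal (1 / L) * emeasure lebesgue Q \<and>
    (\<forall>R\<in>\<Lambda>. \<bar>avg f R - avg f Q\<bar> \<le> 2 ^ CARD('n) * (L * N)) \<and>
    (AE x in lebesgue. x \<in> Q - \<Union>\<Lambda> \<longrightarrow> \<bar>f x - avg f Q\<bar> \<le> L * N)"
proof -
  define g where "g x = \<bar>f x - avg f Q\<bar>" for x
  let ?g = "\<lambda>x. ennreal (g x)"
  let ?\<nu> = "density lebesgue ?g"
  let ?\<mu> = "density lebesgue (\<lambda>_. ennreal (L * N))"
  have fl: "locally_integrable f" using f by (simp add: BMO_def)
  have gl: "locally_integrable g"
    unfolding g_def using fl by (rule locally_integrable_abs_diff_const)
  have [measurable]: "g \<in> borel_measurable lebesgue"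
    using gl by (rule borel_measurable_of_locally_integrable)
  have nu: "emeasure ?\<nu> R = ennreal (avg g R * measure lebesgue R)" if "R \<in> cubes" for R
    using emeasure_density_cubes[OF gl _ that] emeasure_cubes(1)[OF that]
    by (simp add: avg_def g_def)
  have avgQ: "avg g Q \<le> N"
    unfolding g_def using f N(1) Q by (rule avg_abs_diff_le_bmo_norm)
  have LN: "0 < L * N" "N \<le> L * N" using L N by auto
  have avg0: "emeasure ?\<nu> Q \<le> ennreal N * emeasure lebesgue Q"
    unfolding nu[OF Q] using avgQ emeasure_cubes[OF Q] N
    by (simp add: ennreal_mult[symmetric] ennreal_leI mult_right_mono)
  also have "\<dots> \<le> ennreal (L * N) * emeasure lebesgue Q"
    using LN by (intro mult_right_mono ennreal_leI) auto
  finally have avgLN: "emeasure ?\<nu> Q \<le> ennreal (L * N) * emeasure lebesgue Q" .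
  obtain \<Lambda> where \<Lambda>: "\<Lambda> \<subseteq> cubes" "disjoint \<Lambda>" "\<And>R. R \<in> \<Lambda> \<Longrightarrow> R \<subseteq> Q"
    and big: "\<And>R. R \<in> \<Lambda> \<Longrightarrow> ennreal (L * N) * emeasure lebesgue R \<le> emeasure ?\<nu> R"
    and small: "\<And>R. R \<in> \<Lambda> \<Longrightarrow>
      emeasure ?\<nu> R \<le> ennreal (2 ^ CARD('n) * (L * N)) * emeasure lebesgue R"
    and ae: "AE x in lebesgue. x \<in> Q - \<Union>\<Lambda> \<longrightarrow> ?g x \<le> ennreal (L * N)"
  proof (rule calderon_zygmund[OF Q _ _ avgLN])
    show "0 \<le> L * N" using LN by simp
    show "?g \<in> borel_measurable lebesgue" by measurable
  qed (rule that)
  have sets: "\<Lambda> \<subseteq> sets lebesgue" using \<Lambda>(1) sets_cubes by auto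
  have cnt: "countable \<Lambda>" using \<Lambda> by (intro countable_disjoint_cubes)
  have U: "\<Union>\<Lambda> \<in> sets lebesgue" using cnt sets by (intro sets.countable_Union)
  have "emeasure lebesgue (\<Union>\<Lambda>) \<le> ennreal (1 / L) * emeasure lebesgue Q"
  proof -
    have "emeasure lebesgue (\<Union>\<Lambda>) \<le> emeasure lebesgue Q"
      using \<Lambda>(3) sets_cubes[OF Q] by (intro emeasure_mono) auto
    then obtain u where u: "0 \<le> u" "emeasure lebesgue (\<Union>\<Lambda>) = ennreal u"
      using emeasure_cubes(2)[OF Q] by (cases "emeasure lebesgue (\<Union>\<Lambda>)") (auto simp: top_unique)
    have "ennreal (L * N) * emeasure lebesgue (\<Union>\<Lambda>) = emeasure ?\<mu> (\<Union>\<Lambda>)"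
      using U by (simp add: emeasure_density_const)
    also have "\<dots> \<le> emeasure ?\<nu> (\<Union>\<Lambda>)"
    proof (rule emeasure_Union_mono_disjoint)
      fix P assume P: "P \<in> \<Lambda>"
      then have "P \<in> sets lebesgue" using sets by auto
      then show "emeasure ?\<mu> P \<le> emeasure ?\<nu> P"
        using big[OF P] by (simp add: emeasure_density_const)
    qed (use cnt \<Lambda> sets in auto)
    also have "\<dots> \<le> emeasure ?\<nu> Q"
      using \<Lambda>(3) sets_cubes[OF Q] by (intro emeasure_mono) auto
    also have "\<dots> \<le> ennreal N * emeasure lebesgue Q" by (rule avg0)
    finally have "ennreal (L * N * u) \<le> ennreal (N * measure lebesgue Q)"
      using LN N u emeasure_cubes[OF Q] by (simp add: ennreal_mult)
    then have "N * (L * u) \<le> N * measure lebesgue Q"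
      using N emeasure_cubes(1)[OF Q] by (simp add: ennreal_le_iff ac_simps)
    then have "u \<le> 1 / L * measure lebesgue Q"
      using N L by (simp add: field_simps)
    then have "ennreal u \<le> ennreal (1 / L * measure lebesgue Q)" by (rule ennreal_leI)
    also have "\<dots> = ennreal (1 / L) * emeasure lebesgue Q"
      using L emeasure_cubes[OF Q] by (subst ennreal_mult) auto
    finally show ?thesis using u by simp
  qed
  moreover have "\<bar>avg f R - avg f Q\<bar> \<le> 2 ^ CARD('n) * (L * N)" if R: "R \<in> \<Lambda>" for R
  proof -
    have Rc: "R \<in> cubes" using R \<Lambda> by auto
    have "ennreal (avg g R * measure lebesgue R) \<le> ennreal (2 ^ CARD('n) * (L * N) * measure lebesgue R)"
      using small[OF R] nu[OF Rc] emeasure_cubes[OF Rc] LN by (simp add: ennreal_mult)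
    then have "avg g R * measure lebesgue R \<le> 2 ^ CARD('n) * (L * N) * measure lebesgue R"
      using emeasure_cubes[OF Rc] LN by (subst (asm) ennreal_le_iff) auto
    then have "avg g R \<le> 2 ^ CARD('n) * (L * N)"
      using emeasure_cubes(1)[OF Rc] by simp
    moreover have "\<bar>avg f R - avg f Q\<bar> \<le> avg g R"
      unfolding g_def using fl Rc by (rule abs_avg_diff_le)
    ultimately show ?thesis by simp
  qed
  moreover have "AE x in lebesgue. x \<in> Q - \<Union>\<Lambda> \<longrightarrow> \<bar>f x - avg f Q\<bar> \<le> L * N"
    using ae LN by (simp add: g_def ennreal_le_iff)
  ultimately show ?thesis using \<Lambda> by blast
qed

primrec descendants :: "('a set \<Rightarrow> 'a set set) \<Rightarrow> 'a set \<Rightarrow> nat \<Rightarrow> 'a set set" where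
  "descendants S Q 0 = {Q}"
| "descendants S Q (Suc k) = (\<Union>P\<in>descendants S Q k. S P)"

text \<open>
  Each generation loses a factor \<open>L\<close> in measure, because this happens inside every single cube of
  the previous one.
\<close>

lemma descendants_small_family:
  fixes S :: "(real ^ 'n) set \<Rightarrow> (real ^ 'n) set set"
  assumes Q: "Q \<in> cubes" and L: "1 \<le> L"
    and S: "\<And>P. P \<in> cubes \<Longrightarrow> S P \<subseteq> cubes" "\<And>P. P \<in> cubes \<Longrightarrow> disjoint (S P)"
      "\<And>P R. P \<in> cubes \<Longrightarrow> R \<in> S P \<Longrightarrow> R \<subseteq> P"
      "\<And>P. P \<in> cubes \<Longrightarrow> emeasure lebesgue (\<Union>(S P)) \<le> ennreal (1 / L) * emeasure lebesgue P"
  shows "descendants S Q k \<in> small_families (L ^ k) Q"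
    and "\<Union>(descendants S Q (Suc k)) \<subseteq> \<Union>(descendants S Q k)"
    and "emeasure lebesgue (\<Union>(descendants S Q k)) \<le> ennreal (1 / L ^ k) * emeasure lebesgue Q"
proof -
  let ?D = "descendants S Q"
  have cub: "?D k \<subseteq> cubes" for k
    by (induction k) (use Q S(1) in auto)
  show mono: "\<Union>(?D (Suc k)) \<subseteq> \<Union>(?D k)" for k
    using cub[of k] S(3) by fastforce
  have sub: "\<Union>(?D k) \<subseteq> Q" for k
  proof (induction k)
    case (Suc k)
    with mono[of k] show ?case by (rule order_trans)
  qed auto
  have dis: "disjoint (?D k)" for k
  proof (induction k)
    case (Suc k)
    show ?case
    proof (rule disjointI)
      fix R R' assume "R \<in> ?D (Suc k)" "R' \<in> ?D (Suc k)" and ne: "R \<noteq> R'"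
      then obtain P P' where P: "P \<in> ?D k" "R \<in> S P" "P' \<in> ?D k" "R' \<in> S P'" by auto
      then have c: "P \<in> cubes" "P' \<in> cubes" using cub[of k] by auto
      show "R \<inter> R' = {}"
      proof (cases "P = P'")
        case True
        then show ?thesis using disjointD[OF S(2)[OF c(1)]] P ne by auto
      next
        case False
        then show ?thesis
          using disjointD[OF Suc P(1,3)] S(3)[OF c(1) P(2)] S(3)[OF c(2) P(4)] by auto
      qed
    qed
  qed auto
  have cnt: "countable (?D k)" for k
    using cub dis by (rule countable_disjoint_cubes)
  have sets: "?D k \<subseteq> sets lebesgue" for k
    using cub[of k] sets_cubes by auto
  have U [measurable]: "\<Union>(?D k) \<in> sets lebesgue" for k
    using cnt sets by (rule sets.countable_Union)
  show le: "emeasure lebesgue (\<Union>(?D k)) \<le> ennreal (1 / L ^ k) * emeasure lebesgue Q" for k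
  proof (induction k)
    case 0
    then show ?case by simp
  next
    case (Suc k)
    \<comment> \<open>The measure of the next generation inside each cube of this one, against a multiple of
      Lebesgue measure\<close>
    let ?M = "density lebesgue (indicator (\<Union>(?D (Suc k))))"
    let ?N = "density lebesgue (\<lambda>_. ennreal (1 / L))"
    have ind: "emeasure ?M A = emeasure lebesgue (A \<inter> \<Union>(?D (Suc k)))" if "A \<in> sets lebesgue" for A
      using that U[of "Suc k"] by (subst emeasure_density)
        (auto simp: indicator_inter_arith[symmetric] Int_commute simp del: descendants.simps)
    have "emeasure lebesgue (\<Union>(?D (Suc k))) = emeasure ?M (\<Union>(?D k))"
      using mono[of k] by (subst ind[OF U]) (simp add: Int_absorb1 del: descendants.simps)
    also have "\<dots> \<le> emeasure ?N (\<Union>(?D k))"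
    proof (rule emeasure_Union_mono_disjoint)
      fix P assume P: "P \<in> ?D k"
      then have Pc: "P \<in> cubes" and Ps: "P \<in> sets lebesgue" using cub[of k] sets[of k] by auto
      have SU: "\<Union>(S P) \<in> sets lebesgue"
        using countable_disjoint_cubes[OF S(1)[OF Pc] S(2)[OF Pc]] S(1)[OF Pc] sets_cubes
        by (intro sets.countable_Union) auto
      have "P \<inter> \<Union>(?D (Suc k)) \<subseteq> \<Union>(S P)"
      proof
        fix x assume x: "x \<in> P \<inter> \<Union>(?D (Suc k))"
        then obtain P' R where P': "P' \<in> ?D k" "R \<in> S P'" "x \<in> R" by auto
        then have "x \<in> P'" using S(3)[of P' R] cub[of k] by auto
        then have "P = P'" using disjointD[OF dis P P'(1)] x by auto
        then show "x \<in> \<Union>(S P)" using P' by auto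
      qed
      then have "emeasure lebesgue (P \<inter> \<Union>(?D (Suc k))) \<le> emeasure lebesgue (\<Union>(S P))"
        using SU by (rule emeasure_mono)
      also have "\<dots> \<le> ennreal (1 / L) * emeasure lebesgue P" by (rule S(4)[OF Pc])
      finally show "emeasure ?M P \<le> emeasure ?N P"
        using Ps ind[OF Ps] by (simp add: emeasure_density_const del: descendants.simps)
    qed (use cnt dis sets in auto)
    also have "\<dots> = ennreal (1 / L) * emeasure lebesgue (\<Union>(?D k))"
      by (rule emeasure_density_const[OF U])
    also have "\<dots> \<le> ennreal (1 / L) * (ennreal (1 / L ^ k) * emeasure lebesgue Q)"
      by (intro mult_left_mono Suc) auto
    also have "\<dots> = ennreal (1 / L ^ Suc k) * emeasure lebesgue Q"
      using L by (simp add: mult.assoc[symmetric] ennreal_mult[symmetric] del: ennreal_power)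
    finally show ?case .
  qed
  have "emeasure lebesgue Q / ennreal (L ^ k) = ennreal (1 / L ^ k * measure lebesgue Q)"
    using L emeasure_cubes[OF Q] by (simp add: divide_ennreal)
  also have "\<dots> = ennreal (1 / L ^ k) * emeasure lebesgue Q"
    using L emeasure_cubes[OF Q] by (subst ennreal_mult) auto
  finally have "ennreal (1 / L ^ k) * emeasure lebesgue Q = emeasure lebesgue Q / ennreal (L ^ k)" ..
  then show "?D k \<in> small_families (L ^ k) Q"
    unfolding small_families_def
    using cub[of k] dis[of k] sub[of k] le[of k] infsum_emeasure_disjoint[OF cnt dis sets, of k]
    by auto
qed

text \<open>
  With \<open>B = 2\<^sup>n e N\<close>, the averages move by at most \<open>B\<close> from one generation to the next, so on a cube of generation
  \<open>k\<close> they are within \<open>k B\<close> of \<open>avg f Q\<close>. Since the measure of the generations decays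
  geometrically, almost every point lies in only finitely many of them, and the last one gives
  the bound.
\<close>

lemma bmo_layers:
  fixes f :: "real ^ 'n \<Rightarrow> real"
  assumes f: "f \<in> BMO" and N: "enn2real (bmo_norm f) \<le> N" "0 < N" and Q: "Q \<in> cubes"
  obtains \<Lambda> where "\<forall>k. \<Lambda> k \<in> small_families (exp (real k)) Q"
    "AE x in lebesgue. x \<in> Q \<longrightarrow> (\<exists>k. (\<forall>j\<le>k. x \<in> \<Union>(\<Lambda> j)) \<and>
        \<bar>f x - avg f Q\<bar> \<le> real (Suc k) * (2 ^ CARD('n) * (exp 1 * N)))"
proof -
  define B where "B = 2 ^ CARD('n) * (exp 1 * N)"
  have LB: "exp 1 * N \<le> B"
  proof -
    have "1 * (exp 1 * N) \<le> B"
      unfolding B_def using N(2) by (intro mult_right_mono) auto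
    then show ?thesis by simp
  qed
  have "\<forall>P\<in>cubes. \<exists>\<Lambda>. \<Lambda> \<subseteq> cubes \<and> disjoint \<Lambda> \<and> (\<forall>R\<in>\<Lambda>. R \<subseteq> P) \<and>
    emeasure lebesgue (\<Union>\<Lambda>) \<le> ennreal (1 / exp 1) * emeasure lebesgue P \<and>
    (\<forall>R\<in>\<Lambda>. \<bar>avg f R - avg f P\<bar> \<le> 2 ^ CARD('n) * (exp 1 * N)) \<and>
    (AE x in lebesgue. x \<in> P - \<Union>\<Lambda> \<longrightarrow> \<bar>f x - avg f P\<bar> \<le> exp 1 * N)"
    by (intro ballI bmo_stopping_cubes f N) auto
  from bchoice[OF this] obtain S where S': "\<forall>P\<in>cubes. S P \<subseteq> cubes \<and> disjoint (S P) \<and> (\<forall>R\<in>S P. R \<subseteq> P) \<and>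
    emeasure lebesgue (\<Union>(S P)) \<le> ennreal (1 / exp 1) * emeasure lebesgue P \<and>
    (\<forall>R\<in>S P. \<bar>avg f R - avg f P\<bar> \<le> B) \<and>
    (AE x in lebesgue. x \<in> P - \<Union>(S P) \<longrightarrow> \<bar>f x - avg f P\<bar> \<le> exp 1 * N)"
    unfolding B_def by blast
  have S: "S P \<subseteq> cubes" "disjoint (S P)" "\<And>R. R \<in> S P \<Longrightarrow> R \<subseteq> P"
    "emeasure lebesgue (\<Union>(S P)) \<le> ennreal (1 / exp 1) * emeasure lebesgue P"
    "\<And>R. R \<in> S P \<Longrightarrow> \<bar>avg f R - avg f P\<bar> \<le> B"
    "AE x in lebesgue. x \<in> P - \<Union>(S P) \<longrightarrow> \<bar>f x - avg f P\<bar> \<le> exp 1 * N"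
    if "P \<in> cubes" for P
    using bspec[OF S' that] by auto
  let ?D = "descendants S Q"
  have one: "1 \<le> (exp 1 :: real)" by simp
  note D = descendants_small_family[where S = S, OF Q one S(1,2,3,4)]
  have cub: "?D k \<subseteq> cubes" "disjoint (?D k)" for k
    using D(1)[of k] by (auto simp: small_families_def)
  have avgD: "\<bar>avg f P - avg f Q\<bar> \<le> real k * B" if "P \<in> ?D k" for k P
    using that
  proof (induction k arbitrary: P)
    case (Suc k)
    then obtain P' where P': "P' \<in> ?D k" "P \<in> S P'" by auto
    then have "P' \<in> cubes" using cub by auto
    from S(5)[OF this P'(2)] Suc.IH[OF P'(1)] show ?case by (simp add: algebra_simps)
  qed simp
  have layer: "AE x in lebesgue. \<forall>P\<in>?D k. x \<in> P - \<Union>(S P) \<longrightarrow> \<bar>f x - avg f P\<bar> \<le> exp 1 * N" for k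
    using cub S(6) by (intro AE_ball_countable' countable_disjoint_cubes) auto
  have U: "\<Union>(?D k) \<in> sets lebesgue" for k
    using cub[of k] sets_cubes countable_disjoint_cubes[OF cub]
    by (intro sets.countable_Union) auto
  have "(\<Inter>k. \<Union>(?D k)) \<in> null_sets lebesgue"
  proof (rule null_setsI)
    show "(\<Inter>k. \<Union>(?D k)) \<in> sets lebesgue" using U by (intro sets.countable_INT) auto
    obtain m where m: "0 < m" "emeasure lebesgue Q = ennreal m" using emeasure_cubes[OF Q] by metis
    have le: "emeasure lebesgue (\<Inter>k. \<Union>(?D k)) \<le> ennreal ((1 / exp 1) ^ k * m)" for k
    proof -
      have "emeasure lebesgue (\<Inter>k. \<Union>(?D k)) \<le> emeasure lebesgue (\<Union>(?D k))"
        using U by (intro emeasure_mono) auto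
      also have "\<dots> \<le> ennreal (1 / exp 1 ^ k) * emeasure lebesgue Q" by (rule D(3))
      also have "\<dots> = ennreal ((1 / exp 1) ^ k * m)"
        using m by (subst ennreal_mult) (auto simp: power_one_over)
      finally show ?thesis .
    qed
    have "(\<lambda>k. (1 / exp 1 :: real) ^ k * m) \<longlonglongrightarrow> 0 * m"
      by (intro tendsto_mult LIMSEQ_power_zero tendsto_const) auto
    then have "(\<lambda>k. ennreal ((1 / exp 1 :: real) ^ k * m)) \<longlonglongrightarrow> ennreal 0"
      by (intro tendsto_ennrealI) simp
    then have "emeasure lebesgue (\<Inter>k. \<Union>(?D k)) \<le> ennreal 0"
      by (rule LIMSEQ_le_const) (use le in auto)
    then show "emeasure lebesgue (\<Inter>k. \<Union>(?D k)) = 0" by simp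
  qed
  then have "AE x in lebesgue. x \<notin> (\<Inter>k. \<Union>(?D k))" by (rule AE_not_in)
  moreover have "AE x in lebesgue. \<forall>k. \<forall>P\<in>?D k. x \<in> P - \<Union>(S P) \<longrightarrow> \<bar>f x - avg f P\<bar> \<le> exp 1 * N"
    using layer by (simp add: AE_all_countable)
  ultimately have ae: "AE x in lebesgue. x \<in> Q \<longrightarrow> (\<exists>k. (\<forall>j\<le>k. x \<in> \<Union>(?D j)) \<and>
        \<bar>f x - avg f Q\<bar> \<le> real (Suc k) * B)"
  proof eventually_elim
    case (elim x)
    show ?case
    proof
      assume "x \<in> Q"
      define k where "k = (LEAST k. x \<notin> \<Union>(?D k))"
      have "\<exists>k. x \<notin> \<Union>(?D k)" using elim(1) by auto
      then have k: "x \<notin> \<Union>(?D k)" "\<And>j. j < k \<Longrightarrow> x \<in> \<Union>(?D j)"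
        unfolding k_def by (rule LeastI_ex) (use not_less_Least in blast)
      have "k \<noteq> 0" using k(1) \<open>x \<in> Q\<close> by (cases k) auto
      then obtain i where i: "k = Suc i" by (cases k) auto
      then obtain P where P: "P \<in> ?D i" "x \<in> P" using k(2)[of i] by auto
      have "x \<notin> \<Union>(S P)" using k(1) P(1) unfolding i by auto
      then have "\<bar>f x - avg f P\<bar> \<le> B" using elim(2) P LB by fastforce
      with avgD[OF P(1)] have "\<bar>f x - avg f Q\<bar> \<le> real (Suc i) * B" by (simp add: algebra_simps)
      moreover have "\<forall>j\<le>i. x \<in> \<Union>(?D j)" using k(2) i by (simp add: less_Suc_eq_le)
      ultimately show "\<exists>k. (\<forall>j\<le>k. x \<in> \<Union>(?D j)) \<and> \<bar>f x - avg f Q\<bar> \<le> real (Suc k) * B"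
        by blast
    qed
  qed
  show ?thesis
  proof
    show "\<forall>k. ?D k \<in> small_families (exp (real k)) Q"
      using D(1) exp_of_nat_mult[of _ "1::real"] by simp
  qed (use ae in \<open>simp only: B_def\<close>)
qed

section \<open>Summation over the layers\<close>

text \<open>
  The difference of the powers is at most \<open>p (k + 1)\<^bsup>p-1\<^esup>\<close>. Half of the exponential factor
  absorbs the power, by \<open>u \<le> e\<^sup>u\<close> with \<open>u = (k + 1) / (2 p q)\<close>, at the price of
  \<open>(2 p q)\<^bsup>p-1\<^esup>\<close>. The other half leaves a geometric series with sum about \<open>2 q\<close>, which
  together with the factor \<open>p\<close> completes the power \<open>(2 p q)\<^sup>p\<close>.
\<close>

lemma exp_weighted_power_differences_bound:
  fixes p q :: real
  assumes p: "1 \<le> p" and q: "1 < q"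
  shows "(\<Sum>k. ennreal ((real (Suc k) powr p - real k powr p) * exp (- real k / q)))
    \<le> ennreal (exp 1 * (2 * p * q) powr p)"
proof -
  define r where "r = exp (- 1 / (2 * q))"
  define C where "C = p * (2 * p * q) powr (p - 1) * exp (1 / (2 * q))"
  have r: "0 < r" "r < 1" using q by (auto simp: r_def)
  have C: "0 \<le> C" using p by (simp add: C_def)
  have term_le: "(real (Suc k) powr p - real k powr p) * exp (- real k / q) \<le> C * r ^ k" for k
  proof -
    define t where "t = real (Suc k)"
    define u where "u = t / (2 * p * q)"
    have t: "0 < t" "real k = t - 1" "0 \<le> t - 1" by (auto simp: t_def)
    have u: "0 < u" "t = 2 * p * q * u" using p q t by (auto simp: u_def)
    have diff: "t powr p - (t - 1) powr p \<le> p * t powr (p - 1)"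
    proof (cases "t = 1")
      case True then show ?thesis using p by simp
    next
      case False
      then have t1: "1 < t" using t by auto
      have "\<exists>z. z > t - 1 \<and> z < t \<and> t powr p - (t - 1) powr p = (t - (t - 1)) * (p * z powr (p - 1))"
        using t1 by (intro MVT2) (auto intro!: derivative_eq_intros)
      then obtain z where z: "z > t - 1" "z < t" "t powr p - (t - 1) powr p = p * z powr (p - 1)"
        by auto
      have "z powr (p - 1) \<le> t powr (p - 1)"
        using z t1 p by (intro powr_mono2) auto
      then show ?thesis using z p by simp
    qed
    have "u powr (p - 1) \<le> exp u powr (p - 1)"
      using u p exp_ge_add_one_self[of u] by (intro powr_mono2) linarith+
    also have "\<dots> = exp ((p - 1) * u)" by (simp add: powr_def)
    also have "\<dots> \<le> exp (t / (2 * q))"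
      using p q t u by (auto simp: field_simps)
    finally have "t powr (p - 1) \<le> (2 * p * q) powr (p - 1) * exp (t / (2 * q))"
      using p q u by (simp add: powr_mult)
    then have "p * t powr (p - 1) \<le> p * ((2 * p * q) powr (p - 1) * exp (t / (2 * q)))"
      using p by (intro mult_left_mono) auto
    with diff have "(t powr p - (t - 1) powr p) * exp (- real k / q)
        \<le> p * ((2 * p * q) powr (p - 1) * exp (t / (2 * q))) * exp (- real k / q)"
      by (intro mult_right_mono) auto
    also have "\<dots> = p * (2 * p * q) powr (p - 1) * exp (t / (2 * q) + - real k / q)"
      by (simp only: exp_add mult.assoc)
    also have "t / (2 * q) + - real k / q = 1 / (2 * q) + real k * (- 1 / (2 * q))"
      using q by (simp add: t_def field_simps)
    also have "p * (2 * p * q) powr (p - 1) * exp \<dots> = C * r ^ k"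
      unfolding C_def r_def by (simp only: exp_add exp_of_nat_mult mult.assoc)
    finally show ?thesis by (simp add: t_def)
  qed
  have "(\<Sum>k. ennreal ((real (Suc k) powr p - real k powr p) * exp (- real k / q)))
      \<le> (\<Sum>k. ennreal (C * r ^ k))"
    using term_le by (intro suminf_le ennreal_leI) auto
  also have "\<dots> = ennreal (C * (1 / (1 - r)))"
    using r C by (intro suminf_ennreal_eq sums_mult geometric_sums) auto
  also have "\<dots> \<le> ennreal (exp 1 * (2 * p * q) powr p)"
  proof (rule ennreal_leI)
    have "1 + 1 / (2 * q) \<le> 1 / r"
      using exp_ge_add_one_self[of "1 / (2 * q)"] by (simp add: r_def exp_minus field_simps)
    then have "1 / (1 - r) \<le> 2 * q / r"
      using r q by (simp add: field_simps)
    then have "C * (1 / (1 - r)) \<le> C * (2 * q / r)"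
      using C by (intro mult_left_mono) auto
    also have "\<dots> = (2 * p * q) powr (p - 1) * (2 * p * q) * (exp (1 / (2 * q)) / r)"
      by (simp add: C_def)
    also have "exp (1 / (2 * q)) / r = exp (1 / q)"
      unfolding r_def by (simp add: exp_diff[symmetric])
    also have "(2 * p * q) powr (p - 1) * (2 * p * q) = (2 * p * q) powr p"
      using p q by (simp add: powr_diff)
    also have "(2 * p * q) powr p * exp (1 / q) \<le> (2 * p * q) powr p * exp 1"
      using q by (intro mult_left_mono) auto
    finally show "C * (1 / (1 - r)) \<le> exp 1 * (2 * p * q) powr p" by (simp add: mult.commute)
  qed
  finally show ?thesis .
qed

text \<open>
  On the union of \<open>\<Lambda> k\<close> the smallness of the family turns \<open>w \<le> Y\<close> into exponential decay,
  and the layers are added up with the weights \<open>(k + 1)\<^sup>p - k\<^sup>p\<close>. The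
  integrals are taken in \<^typ>\<open>ennreal\<close>, so that the finiteness of the bound also yields
  integrability.
\<close>

lemma weighted_oscillation_bound:
  fixes f w :: "real ^ 'n \<Rightarrow> real"
  assumes w: "weight w" and q: "1 < q" and Y: "Y \<in> Y_class q"
    and wY: "\<forall>Q\<in>cubes. weighted_measure w Q \<le> Y Q"
    and f: "f \<in> BMO" and N: "enn2real (bmo_norm f) \<le> N" "0 < N"
    and p: "1 \<le> p" and Q: "Q \<in> cubes"
  shows "(\<integral>\<^sup>+x. ennreal (indicator Q x * (\<bar>f x - avg f Q\<bar> powr p * w x)) \<partial>lebesgue)
    \<le> ennreal (Y Q * beta q Y * exp 1 * (2 * p * q * (2 ^ CARD('n) * (exp 1 * N))) powr p)"
proof -
  define B where "B = 2 ^ CARD('n) * (exp 1 * N)"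
  define b where "b = beta q Y"
  have B: "0 < B" using N by (simp add: B_def)
  have YQ: "0 < Y Q" using Y Q by (simp add: Y_class_def)
  have b: "smallness_bound q Y b" unfolding b_def by (rule beta_least(1)[OF Y])
  then have b0: "0 < b" by (simp add: smallness_bound_def)
  obtain \<Lambda> where \<Lambda>': "\<forall>k. \<Lambda> k \<in> small_families (exp (real k)) Q"
    and ae: "AE x in lebesgue. x \<in> Q \<longrightarrow> (\<exists>k. (\<forall>j\<le>k. x \<in> \<Union>(\<Lambda> j)) \<and>
        \<bar>f x - avg f Q\<bar> \<le> real (Suc k) * B)"
    unfolding B_def by (rule bmo_layers[OF f N Q])
  have \<Lambda>: "\<Lambda> k \<in> small_families (exp (real k)) Q" for k using \<Lambda>' by simp
  have w0: "0 \<le> w x" for x using w by (simp add: weight_def)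
  have wl: "locally_integrable w" using w by (simp add: weight_def)
  have [measurable]: "w \<in> borel_measurable lebesgue"
    using wl by (rule borel_measurable_of_locally_integrable)
  have cub: "\<Lambda> k \<subseteq> cubes" "disjoint (\<Lambda> k)" for k using \<Lambda>[of k] by (auto simp: small_families_def)
  have sets: "\<Lambda> k \<subseteq> sets lebesgue" for k using cub[of k] sets_cubes by auto
  have cnt: "countable (\<Lambda> k)" for k using cub by (rule countable_disjoint_cubes)
  have U [measurable]: "\<Union>(\<Lambda> k) \<in> sets lebesgue" for k
    using cnt sets by (rule sets.countable_Union)
  let ?\<omega> = "density lebesgue (\<lambda>x. ennreal (w x))"
  have layer: "emeasure ?\<omega> (\<Union>(\<Lambda> k)) \<le> ennreal (b * Y Q * exp (- real k / q))" for k
  proof -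
    have "emeasure ?\<omega> (\<Union>(\<Lambda> k)) = (\<Sum>\<^sub>\<infinity>P\<in>\<Lambda> k. emeasure ?\<omega> P)"
      using cnt cub sets by (intro infsum_emeasure_disjoint[symmetric]) auto
    also have "\<dots> \<le> (\<Sum>\<^sub>\<infinity>P\<in>\<Lambda> k. ennreal (Y P))"
    proof (intro infsum_mono nonneg_summable_on_complete)
      fix P assume "P \<in> \<Lambda> k"
      then have "P \<in> cubes" using cub by auto
      then show "emeasure ?\<omega> P \<le> ennreal (Y P)"
        using emeasure_density_cubes[OF wl w0] wY by (auto simp: weighted_measure_def intro: ennreal_leI)
    qed auto
    also have "\<dots> \<le> ennreal (b * Y Q * (1 / exp (real k)) powr (1 / q))"
      using b Q \<Lambda>[of k] unfolding smallness_bound_def by auto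
    also have "(1 / exp (real k)) powr (1 / q) = exp (- real k / q)"
      by (simp add: powr_def ln_div)
    finally show ?thesis .
  qed
  define a where "a k = real (Suc k) powr p - real k powr p" for k
  have a0: "0 \<le> a k" for k unfolding a_def using p by (simp add: powr_mono2)
  have sum_a: "(\<Sum>j\<le>k. a j) = real (Suc k) powr p" for k
    by (induction k) (use p in \<open>auto simp: a_def\<close>)
  \<comment> \<open>At a point of the layer \<open>k\<close> the first \<open>k + 1\<close> terms of the series telescope to
    \<open>(k + 1) powr p\<close>.\<close>
  have pointwise: "AE x in lebesgue. ennreal (indicator Q x * (\<bar>f x - avg f Q\<bar> powr p * w x))
      \<le> (\<Sum>k. ennreal (B powr p * a k) * (ennreal (w x) * indicator (\<Union>(\<Lambda> k)) x))"
    using ae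
  proof eventually_elim
    case (elim x)
    show ?case
    proof (cases "x \<in> Q")
      case True
      then obtain k where k: "\<forall>j\<le>k. x \<in> \<Union>(\<Lambda> j)" "\<bar>f x - avg f Q\<bar> \<le> real (Suc k) * B"
        using elim by blast
      have "\<bar>f x - avg f Q\<bar> powr p \<le> (real (Suc k) * B) powr p"
        using k(2) p by (intro powr_mono2) auto
      also have "\<dots> = B powr p * (\<Sum>j\<le>k. a j)"
        using B by (simp add: sum_a powr_mult mult.commute del: of_nat_Suc)
      also have "\<dots> = (\<Sum>j\<le>k. B powr p * a j)" by (rule sum_distrib_left)
      finally have "\<bar>f x - avg f Q\<bar> powr p * w x \<le> (\<Sum>j\<le>k. B powr p * a j) * w x"
        using w0 by (rule mult_right_mono)
      then have "ennreal (indicator Q x * (\<bar>f x - avg f Q\<bar> powr p * w x))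
          \<le> ennreal (\<Sum>j\<le>k. B powr p * a j * w x)"
        using True by (simp add: sum_distrib_right ennreal_leI)
      also have "\<dots> = (\<Sum>j\<le>k. ennreal (B powr p * a j * w x))"
        using a0 w0 by (intro sum_ennreal[symmetric]) auto
      also have "\<dots> = (\<Sum>j\<le>k. ennreal (B powr p * a j) * (ennreal (w x) * indicator (\<Union>(\<Lambda> j)) x))"
        using k(1) a0 w0 by (intro sum.cong refl) (simp add: ennreal_mult)
      also have "\<dots> \<le> (\<Sum>k. ennreal (B powr p * a k) * (ennreal (w x) * indicator (\<Union>(\<Lambda> k)) x))"
        by (intro sum_le_suminf) auto
      finally show ?thesis .
    qed simp
  qed
  have "(\<integral>\<^sup>+x. ennreal (indicator Q x * (\<bar>f x - avg f Q\<bar> powr p * w x)) \<partial>lebesgue)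
      \<le> (\<integral>\<^sup>+x. (\<Sum>k. ennreal (B powr p * a k) * (ennreal (w x) * indicator (\<Union>(\<Lambda> k)) x)) \<partial>lebesgue)"
    using pointwise by (rule nn_integral_mono_AE)
  also have "\<dots> = (\<Sum>k. ennreal (B powr p * a k) * emeasure ?\<omega> (\<Union>(\<Lambda> k)))"
    by (subst nn_integral_suminf) (auto simp: nn_integral_cmult emeasure_density)
  also have "\<dots> \<le> (\<Sum>k. ennreal (B powr p * b * Y Q) * ennreal (a k * exp (- real k / q)))"
  proof (intro suminf_le)
    fix k
    have "ennreal (B powr p * a k) * emeasure ?\<omega> (\<Union>(\<Lambda> k))
        \<le> ennreal (B powr p * a k) * ennreal (b * Y Q * exp (- real k / q))"
      by (intro mult_left_mono layer) auto
    also have "\<dots> = ennreal (B powr p * b * Y Q) * ennreal (a k * exp (- real k / q))"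
      using a0 b0 YQ by (simp add: ennreal_mult[symmetric] ac_simps)
    finally show "ennreal (B powr p * a k) * emeasure ?\<omega> (\<Union>(\<Lambda> k))
        \<le> ennreal (B powr p * b * Y Q) * ennreal (a k * exp (- real k / q))" .
  qed auto
  also have "\<dots> = ennreal (B powr p * b * Y Q) * (\<Sum>k. ennreal (a k * exp (- real k / q)))"
    by (rule ennreal_suminf_cmult)
  also have "\<dots> \<le> ennreal (B powr p * b * Y Q) * ennreal (exp 1 * (2 * p * q) powr p)"
    unfolding a_def by (intro mult_left_mono exp_weighted_power_differences_bound p q) auto
  also have "\<dots> = ennreal (Y Q * b * exp 1 * (2 * p * q * B) powr p)"
    using b0 YQ p q B by (simp add: ennreal_mult[symmetric] powr_mult ac_simps)
  finally show ?thesis unfolding B_def b_def .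
qed

theorem theorem1p6:
  shows "\<exists>c>0. \<forall>(w :: real ^ 'n \<Rightarrow> real) (q::real) (Y :: (real ^ 'n) set \<Rightarrow> real).
    weight w \<longrightarrow> 1 < q \<longrightarrow> Y \<in> Y_class q \<longrightarrow> (\<forall>Q\<in>cubes. weighted_measure w Q \<le> Y Q) \<longrightarrow>
    (\<forall>f\<in>BMO. \<forall>p\<ge>1. \<forall>Q\<in>cubes.
       set_integrable lebesgue Q (\<lambda>x. \<bar>f x - avg f Q\<bar> powr p * w x) \<and>
       (1 / Y Q * (LINT x:Q|lebesgue. \<bar>f x - avg f Q\<bar> powr p * w x)) powr (1 / p)
         \<le> c * p * q * beta q Y * enn2real (bmo_norm f))"
proof (intro exI[of _ "2 * exp 1 * exp 1 * 2 ^ CARD('n)"] conjI allI impI ballI)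
  fix w f :: "real ^ 'n \<Rightarrow> real" and q p :: real and Y :: "(real ^ 'n) set \<Rightarrow> real" and Q :: "(real ^ 'n) set"
  assume w: "weight w" and q: "1 < q" and Y: "Y \<in> Y_class q"
    and wY: "\<forall>Q\<in>cubes. weighted_measure w Q \<le> Y Q"
    and f: "f \<in> BMO" and p: "1 \<le> p" and Q: "Q \<in> cubes"
  define b where "b = beta q Y"
  define M where "M = enn2real (bmo_norm f)"
  define h where "h x = indicator Q x * (\<bar>f x - avg f Q\<bar> powr p * w x)" for x
  have YQ: "0 < Y Q" using Y Q by (simp add: Y_class_def)
  have b1: "1 \<le> b"
    unfolding b_def using Y beta_least(1)[OF Y]
    by (intro smallness_bound_ge_1) (auto simp: Y_class_def)
  have h0: "0 \<le> h x" for x using w by (simp add: h_def weight_def)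
  have M0: "0 \<le> M" by (simp add: M_def)
  have [measurable]: "f \<in> borel_measurable lebesgue" "w \<in> borel_measurable lebesgue"
    using f w by (auto simp: BMO_def weight_def intro: borel_measurable_of_locally_integrable)
  have [measurable]: "Q \<in> sets lebesgue" using Q by (rule sets_cubes)
  have [measurable]: "h \<in> borel_measurable lebesgue" unfolding h_def by measurable
  have bound: "(\<integral>\<^sup>+x. ennreal (h x) \<partial>lebesgue)
      \<le> ennreal (Y Q * b * exp 1 * (2 * p * q * (2 ^ CARD('n) * (exp 1 * N))) powr p)"
    if "M < N" for N
  proof -
    have "enn2real (bmo_norm f) \<le> N" "0 < N" using that M0 unfolding M_def by linarith+
    from weighted_oscillation_bound[OF w q Y wY f this p Q] show ?thesis
      unfolding h_def b_def .
  qed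
  have int: "integrable lebesgue h"
    using bound[of "M + 1"] h0
    by (intro integrableI_nonneg) (auto simp: le_less_trans)
  then show "set_integrable lebesgue Q (\<lambda>x. \<bar>f x - avg f Q\<bar> powr p * w x)"
    by (simp add: set_integrable_def h_def[abs_def])
  have LINT: "(LINT x:Q|lebesgue. \<bar>f x - avg f Q\<bar> powr p * w x) = integral\<^sup>L lebesgue h"
    by (simp add: set_lebesgue_integral_def h_def[abs_def])
  have I0: "0 \<le> integral\<^sup>L lebesgue h" using h0 by simp
  let ?c = "2 * exp 1 * exp 1 * 2 ^ CARD('n)"
  let ?X = "(1 / Y Q * (LINT x:Q|lebesgue. \<bar>f x - avg f Q\<bar> powr p * w x)) powr (1 / p)"
  let ?K = "?c * p * q * b"
  have K: "0 < ?K" using p q b1 by simp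
  \<comment> \<open>The bound needs a strictly positive \<open>N\<close>, whereas the norm may be \<open>0\<close>; hence the passage
    to the limit below.\<close>
  have le: "?X \<le> ?K * N" if N: "M < N" for N
  proof -
    define G where "G = 2 * p * q * (2 ^ CARD('n) * (exp 1 * N))"
    have G: "0 < G" using p q N M0 by (simp add: G_def)
    have "ennreal (integral\<^sup>L lebesgue h) \<le> ennreal (Y Q * b * exp 1 * G powr p)"
      using bound[OF N] nn_integral_eq_integral[OF int] h0 by (simp add: G_def)
    then have "integral\<^sup>L lebesgue h \<le> Y Q * b * exp 1 * G powr p"
      using YQ b1 by (subst (asm) ennreal_le_iff) auto
    then have "1 / Y Q * integral\<^sup>L lebesgue h \<le> b * exp 1 * G powr p"
      using YQ by (simp add: field_simps)
    then have "?X \<le> (b * exp 1 * G powr p) powr (1 / p)"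
      unfolding LINT using I0 YQ p by (intro powr_mono2) auto
    also have "\<dots> = (b * exp 1) powr (1 / p) * G"
      using b1 G p by (simp add: powr_mult powr_powr)
    also have "\<dots> \<le> (b * exp 1) powr 1 * G"
    proof -
      have "1 * 1 \<le> b * exp 1" using b1 by (intro mult_mono) auto
      then show ?thesis using p G by (intro mult_right_mono powr_mono) auto
    qed
    also have "\<dots> = ?K * N" using b1 by (simp add: G_def)
    finally show ?thesis .
  qed
  have "?X / ?K \<le> M"
  proof (rule dense_ge)
    fix N assume "M < N"
    from le[OF this] show "?X / ?K \<le> N" using K by (simp add: field_simps)
  qed
  then show "?X \<le> ?c * p * q * beta q Y * enn2real (bmo_norm f)"
    using K unfolding b_def[symmetric] M_def[symmetric] by (simp add: field_simps)
qed simp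

end
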